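(* Let $G$ be a connected finite simple graph, let $F$ be a connected $r$-regular graph on vertices $v_1,\dots,v_{\nu_F}$, and let $\phi:E(\vec G)\to\mathrm{Aut}(F)$ be a voltage assignment whose values lie in an abelian subgroup $\Gamma$ of $\mathrm{Aut}(F)$. Let $M_\Gamma$ be an invertible matrix such that $M_\Gamma^{-1}P(\gamma)M_\Gamma=\mathrm{diag}(\lambda_{(\gamma,1)},\dots,\lambda_{(\gamma,\nu_F)})$ for all $\gamma\in\Gamma$ and $M_\Gamma^{-1}A(F)M_\Gamma=\mathrm{diag}(\lambda_{(F,1)},\dots,\lambda_{(F,\nu_F)})$. For $i=1,\dots,\nu_F$ let $\omega_i(\phi)$ be the vertex-and-edge weight function on $\vec G$ given by $\omega_i(\phi)(v)=\deg_G(v)$ for $v\in V(\vec G)$ and $\omega_i(\phi)(e)=\lambda_{(\phi(e),i)}$ for $e\in E(\vec G)$. Then $$F_{G\times^\phi F}(\lambda,\mu)=\prod_{i=1}^{\nu_F}F_{\vec G_{\omega_i(\phi)}}\bigl(\lambda+r\mu-\lambda_{(F,i)},\mu\bigr).$$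
   Context: For a graph $X$, $A(X)$ is its adjacency matrix, $\mathcal{D}(X)$ its degree matrix, $F_X(\lambda,\mu)=\det(\lambda I-(A(X)-\mu\mathcal{D}(X)))$. $\vec G$ is the digraph obtained from $G$ by replacing each edge by two oppositely directed edges; a voltage assignment satisfies $\phi(e^{-1})=\phi(e)^{-1}$. The graph bundle $G\times^\phi F$ has vertex set $V(G)\times V(F)$ with $(u_1,v_1)\sim(u_2,v_2)$ iff either $u_1u_2\in E(\vec G)$ and $v_2=\phi(u_1u_2)(v_1)$, or $u_1=u_2$ and $v_1v_2\in E(F)$. $P(\gamma)$ is the $\nu_F\times\nu_F$ matrix with $(i,j)$-entry $1$ iff $\gamma(v_i)=v_j$; such $M_\Gamma$ exists since these matrices commute and are diagonalizable. For a digraph $D$ with vertices $w_1,\dots,w_k$ and weight function $\omega:V(D)\cup E(D)\to\mathbb{C}$, $D_\omega$ denotes the weighted digraph, $A(D_\omega)$ is the $k\times k$ matrix with $(a,b)$-entry $\sum_{e\text{ from }w_a\text{ to }w_b}\omega(e)$, $\mathcal{D}_{D_\omega}$ is the diagonal matrix with $(a,a)$-entry $\omega(w_a)$, and $F_{D_\omega}(\lambda,\mu)=\det(\lambda I-(A(D_\omega)-\mu\mathcal{D}_{D_\omega}))$. *)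

theory Defs
  imports
    "Graph_Theory.Graph_Theory"
    "Jordan_Normal_Form.Determinant"
    "HOL-Algebra.Bij"
begin

text \<open>
  A finite simple graph is a \<^locale>\<open>pair_graph\<close>, i.e. a finite loopless symmetric set of
  vertex pairs.  In this representation the digraph obtained by replacing every edge of \<open>G\<close> by two
  opposite arcs is \<^term>\<open>with_proj G\<close>, the inverse of the arc \<open>(u, v)\<close> is \<open>(v, u)\<close>, and the degree
  of a vertex is its \<^const>\<open>out_degree\<close>.
  Matrices are taken with respect to an explicit enumeration of the vertices, given as a list;
  indices start at 0.
\<close>

definition enumerates :: "'a list \<Rightarrow> 'a set \<Rightarrow> bool" where
  "enumerates ws V \<longleftrightarrow> distinct ws \<and> set ws = V"

definition regular :: "nat \<Rightarrow> 'a pair_pre_digraph \<Rightarrow> bool" where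
  "regular r X \<longleftrightarrow> (\<forall>v \<in> pverts X. out_degree (with_proj X) v = r)"

definition adjacency_mat :: "'a list \<Rightarrow> 'a pair_pre_digraph \<Rightarrow> complex mat" where
  "adjacency_mat ws X = mat (length ws) (length ws)
     (\<lambda>(a, b). if (ws ! a, ws ! b) \<in> parcs X then 1 else 0)"

definition deg_mat :: "'a list \<Rightarrow> 'a pair_pre_digraph \<Rightarrow> complex mat" where
  "deg_mat ws X = mat_diag (length ws) (\<lambda>a. of_nat (out_degree (with_proj X) (ws ! a)))"

definition gen_char :: "'a list \<Rightarrow> 'a pair_pre_digraph \<Rightarrow> complex \<Rightarrow> complex \<Rightarrow> complex" where
  "gen_char ws X x \<mu> =
     det (x \<cdot>\<^sub>m 1\<^sub>m (length ws) - (adjacency_mat ws X - \<mu> \<cdot>\<^sub>m deg_mat ws X))"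

text \<open>
  A weight function on vertices and arcs is a function on the disjoint union of the vertex type and
  the arc type.
\<close>

definition weighted_adjacency_mat ::
    "'a list \<Rightarrow> ('a, 'b) pre_digraph \<Rightarrow> ('a + 'b \<Rightarrow> complex) \<Rightarrow> complex mat" where
  "weighted_adjacency_mat ws D \<omega> = mat (length ws) (length ws)
     (\<lambda>(a, b). \<Sum>e | e \<in> arcs D \<and> tail D e = ws ! a \<and> head D e = ws ! b. \<omega> (Inr e))"

definition weighted_deg_mat :: "'a list \<Rightarrow> ('a + 'b \<Rightarrow> complex) \<Rightarrow> complex mat" where
  "weighted_deg_mat ws \<omega> = mat_diag (length ws) (\<lambda>a. \<omega> (Inl (ws ! a)))"

definition weighted_gen_char ::
    "'a list \<Rightarrow> ('a, 'b) pre_digraph \<Rightarrow> ('a + 'b \<Rightarrow> complex) \<Rightarrow> complex \<Rightarrow> complex \<Rightarrow> complex" where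
  "weighted_gen_char ws D \<omega> x \<mu> =
     det (x \<cdot>\<^sub>m 1\<^sub>m (length ws) - (weighted_adjacency_mat ws D \<omega> - \<mu> \<cdot>\<^sub>m weighted_deg_mat ws \<omega>))"

definition graph_auts :: "'a pair_pre_digraph \<Rightarrow> ('a \<Rightarrow> 'a) set" where
  "graph_auts X = {f \<in> Bij (pverts X).
     \<forall>u \<in> pverts X. \<forall>v \<in> pverts X. (f u, f v) \<in> parcs X \<longleftrightarrow> (u, v) \<in> parcs X}"

definition Aut_group :: "'a pair_pre_digraph \<Rightarrow> ('a \<Rightarrow> 'a) monoid" where
  "Aut_group X = BijGroup (pverts X) \<lparr>carrier := graph_auts X\<rparr>"

definition voltage_assignment ::
    "'a pair_pre_digraph \<Rightarrow> 'b pair_pre_digraph \<Rightarrow> ('a \<times> 'a \<Rightarrow> 'b \<Rightarrow> 'b) \<Rightarrow> bool" where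
  "voltage_assignment G F \<phi> \<longleftrightarrow>
     (\<forall>e \<in> parcs G. \<phi> e \<in> carrier (Aut_group F)) \<and>
     (\<forall>(u, v) \<in> parcs G. \<phi> (v, u) = inv\<^bsub>Aut_group F\<^esub> (\<phi> (u, v)))"

definition graph_bundle ::
    "'a pair_pre_digraph \<Rightarrow> ('a \<times> 'a \<Rightarrow> 'b \<Rightarrow> 'b) \<Rightarrow> 'b pair_pre_digraph \<Rightarrow>
     ('a \<times> 'b) pair_pre_digraph" where
  "graph_bundle G \<phi> F = \<lparr>
     pverts = pverts G \<times> pverts F,
     parcs = {((u1, v1), (u2, v2)) | u1 v1 u2 v2.
       (u1, v1) \<in> pverts G \<times> pverts F \<and> (u2, v2) \<in> pverts G \<times> pverts F \<and>
       ((u1, u2) \<in> parcs G \<and> v2 = \<phi> (u1, u2) v1 \<or> u1 = u2 \<and> (v1, v2) \<in> parcs F)}\<rparr>"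

definition perm_mat :: "'a list \<Rightarrow> ('a \<Rightarrow> 'a) \<Rightarrow> complex mat" where
  "perm_mat vs \<gamma> = mat (length vs) (length vs) (\<lambda>(i, j). if \<gamma> (vs ! i) = vs ! j then 1 else 0)"

definition voltage_weight ::
    "'a pair_pre_digraph \<Rightarrow> ('a \<times> 'a \<Rightarrow> 'b \<Rightarrow> 'b) \<Rightarrow> (('b \<Rightarrow> 'b) \<Rightarrow> nat \<Rightarrow> complex) \<Rightarrow> nat \<Rightarrow>
     'a + 'a \<times> 'a \<Rightarrow> complex" where
  "voltage_weight G \<phi> ev i =
     case_sum (\<lambda>v. of_nat (out_degree (with_proj G) v)) (\<lambda>e. ev (\<phi> e) i)"

lemma graph_auts_subgroup: "subgroup (graph_auts X) (BijGroup (pverts X))"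
proof (rule group.subgroupI)
  show "group (BijGroup (pverts X))" by (rule group_BijGroup)
  show "graph_auts X \<subseteq> carrier (BijGroup (pverts X))"
    by (auto simp: graph_auts_def BijGroup_def)
  have "(\<lambda>x\<in>pverts X. x) \<in> graph_auts X"
    by (auto simp: graph_auts_def id_Bij)
  then show "graph_auts X \<noteq> {}" by blast
next
  fix f assume f: "f \<in> graph_auts X"
  then have fB: "f \<in> Bij (pverts X)" by (simp add: graph_auts_def)
  have "f ` pverts X = pverts X" using fB by (auto simp: Bij_def bij_betw_def)
  then have *: "inv_into (pverts X) f u \<in> pverts X" "f (inv_into (pverts X) f u) = u"
    if "u \<in> pverts X" for u
    using that by (auto intro: inv_into_into f_inv_into_f)
  have "restrict (inv_into (pverts X) f) (pverts X) \<in> graph_auts X"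
    using f * restrict_inv_into_Bij[OF fB] unfolding graph_auts_def
    by (clarsimp) metis
  then show "inv\<^bsub>BijGroup (pverts X)\<^esub> f \<in> graph_auts X"
    by (simp add: inv_BijGroup[OF fB])
next
  fix f g assume "f \<in> graph_auts X" "g \<in> graph_auts X"
  then show "f \<otimes>\<^bsub>BijGroup (pverts X)\<^esub> g \<in> graph_auts X"
    by (auto simp: graph_auts_def BijGroup_def compose_Bij compose_eq Bij_imp_funcset[THEN funcset_mem])
qed

lemma group_Aut_group: "group (Aut_group X)"
  unfolding Aut_group_def
  by (rule subgroup.subgroup_is_group[OF graph_auts_subgroup group_BijGroup])

end

theory Submission
  imports Defs
begin

text \<open>
  Listing the vertices of the bundle fibre by fibre, the matrix of \<open>G \<times>\<^sup>\<phi> F\<close> becomes a block matrix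
  indexed by \<open>V(G) \<times> V(G)\<close> whose blocks are linear combinations of the identity, of \<open>A(F)\<close> and of the
  permutation matrices \<open>P(\<phi>(e))\<close>; regularity of \<open>F\<close> is what makes the degree part of a diagonal
  block scalar.  Conjugation by the block diagonal matrix with blocks \<open>M\<close> diagonalises all blocks at
  once, and regrouping the indices by the position in the fibre leaves a block diagonal matrix whose
  \<open>i\<close>-th block is the matrix of the weighted digraph with weights \<open>\<omega>\<^sub>i(\<phi>)\<close>.
\<close>

section \<open>Determinants indexed by lists\<close>

text \<open>
  Indexing by list elements rather than by positions makes reordering and regrouping of the index
  set a matter of replacing the list.
\<close>

definition det_on :: "'i list \<Rightarrow> ('i \<Rightarrow> 'i \<Rightarrow> 'c :: idom) \<Rightarrow> 'c" where
  "det_on xs f = det (mat (length xs) (length xs) (\<lambda>(a, b). f (xs ! a) (xs ! b)))"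

lemma det_on_cong:
  assumes "xs = ys" and "\<And>p q. p \<in> set ys \<Longrightarrow> q \<in> set ys \<Longrightarrow> f p q = g p q"
  shows "det_on xs f = det_on ys g"
  unfolding det_on_def assms(1)
  by (rule arg_cong[where f = det], rule eq_matI) (auto simp: assms(2))

lemma det_on_map: "det_on (map h xs) f = det_on xs (\<lambda>p q. f (h p) (h q))"
  unfolding det_on_def by (rule arg_cong[where f = det], rule eq_matI) auto

text \<open>Rows and columns are permuted by the same \<open>p\<close>, so the sign of
  \<open>p\<close> occurs twice and cancels. The matrix \<open>B\<close> has only its columns
  permuted; that half is reduced to a row permutation by transposing.\<close>

lemma det_on_reorder:
  assumes "distinct xs" and "distinct ys" and "set xs = set ys"
  shows "det_on xs f = det_on ys f"
proof -
  have "mset xs = mset ys"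
    using assms set_eq_iff_mset_eq_distinct by blast
  then obtain p where p: "p permutes {..<length ys}" and xs: "permute_list p ys = xs"
    by (rule mset_eq_permutation)
  let ?n = "length ys"
  have pn: "p permutes {0..<?n}" using p by (simp add: lessThan_atLeast0)
  have p_lt: "p i < ?n" if "i < ?n" for i
    using permutes_in_image[OF p] that by auto
  have len: "length xs = ?n" using xs by auto
  have nth: "xs ! i = ys ! p i" if "i < ?n" for i
    using permute_list_nth[OF p that] xs by simp
  define A where "A = mat ?n ?n (\<lambda>(a, b). f (ys ! a) (ys ! b))"
  define B where "B = mat ?n ?n (\<lambda>(a, b). f (ys ! a) (ys ! p b))"
  have A: "A \<in> carrier_mat ?n ?n" and B: "B \<in> carrier_mat ?n ?n"
    by (auto simp: A_def B_def)
  have "det_on xs f = det (mat ?n ?n (\<lambda>(i, j). B $$ (p i, j)))"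
    unfolding det_on_def len
    by (rule arg_cong[where f = det], rule eq_matI) (auto simp: B_def nth p_lt)
  also have "\<dots> = signof p * det B" by (rule det_permute_rows[OF B pn])
  also have "det B = det (transpose_mat B)" using det_transpose[OF B] by simp
  also have "transpose_mat B = mat ?n ?n (\<lambda>(i, j). transpose_mat A $$ (p i, j))"
    by (rule eq_matI) (auto simp: A_def B_def p_lt)
  also have "det \<dots> = signof p * det (transpose_mat A)"
    by (rule det_permute_rows[OF _ pn]) (simp add: A)
  also have "det (transpose_mat A) = det A" by (rule det_transpose[OF A])
  also have "signof p * (signof p * det A) = det A"
    by (cases rule: sign_cases[of p]) simp_all
  finally show ?thesis by (simp add: A_def det_on_def)
qed

text \<open>Distinctness of the list turns the sum over positions in the matrix product into a sum
  over its set of elements.\<close>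

lemma det_on_mult:
  assumes "distinct xs"
  shows "det_on xs f * det_on xs g = det_on xs (\<lambda>p q. \<Sum>s\<in>set xs. f p s * g s q)"
proof -
  let ?n = "length xs"
  let ?A = "mat ?n ?n (\<lambda>(a, b). f (xs ! a) (xs ! b))"
  let ?B = "mat ?n ?n (\<lambda>(a, b). g (xs ! a) (xs ! b))"
  have "det_on xs f * det_on xs g = det (?A * ?B)"
    unfolding det_on_def by (rule det_mult[symmetric]) auto
  also have "?A * ?B = mat ?n ?n (\<lambda>(a, b). \<Sum>s\<in>set xs. f (xs ! a) s * g s (xs ! b))"
    using sum.reindex_bij_betw[OF bij_betw_nth[OF assms refl refl]]
    by (intro eq_matI) (auto simp: scalar_prod_def atLeast0LessThan)
  finally show ?thesis by (simp add: det_on_def)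
qed

lemma det_on_append:
  assumes "\<And>p q. p \<in> set xs \<Longrightarrow> q \<in> set ys \<Longrightarrow> f p q = 0"
  shows "det_on (xs @ ys) f = det_on xs f * det_on ys f"
proof -
  let ?n = "length xs" and ?m = "length ys"
  let ?A = "mat ?n ?n (\<lambda>(a, b). f (xs ! a) (xs ! b))"
  let ?C = "mat ?m ?n (\<lambda>(a, b). f (ys ! a) (xs ! b))"
  let ?D = "mat ?m ?m (\<lambda>(a, b). f (ys ! a) (ys ! b))"
  have "det_on (xs @ ys) f = det (four_block_mat ?A (0\<^sub>m ?n ?m) ?C ?D)"
    unfolding det_on_def
    by (rule arg_cong[where f = det], rule eq_matI) (auto simp: nth_append assms)
  also have "\<dots> = det ?A * det ?D"
    by (rule det_four_block_mat_upper_right_zero) auto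
  finally show ?thesis by (simp add: det_on_def)
qed

lemma det_on_block_diagonal:
  assumes "distinct is"
    and "\<And>i j p q. i \<in> set is \<Longrightarrow> j \<in> set is \<Longrightarrow> i \<noteq> j \<Longrightarrow> p \<in> set (B i) \<Longrightarrow> q \<in> set (B j)
      \<Longrightarrow> f p q = 0"
  shows "det_on (concat (map B is)) f = (\<Prod>i\<in>set is. det_on (B i) f)"
  using assms
proof (induction "is")
  case Nil
  then show ?case by (simp add: det_on_def)
next
  case (Cons i "is")
  have "det_on (B i @ concat (map B is)) f = det_on (B i) f * det_on (concat (map B is)) f"
    by (rule det_on_append) (use Cons.prems in auto)
  moreover have "det_on (concat (map B is)) f = (\<Prod>i\<in>set is. det_on (B i) f)"
    by (rule Cons.IH) (use Cons.prems in auto)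
  ultimately show ?case using Cons.prems(1) by simp
qed

section \<open>Block matrices with simultaneously diagonalizable blocks\<close>

text \<open>The block diagonal matrices built from copies of \<open>N\<close> and of
  \<open>M\<close> have determinants with product 1. Multiplying by them from the left and right
  thus preserves the determinant, while each block becomes \<open>N * B u u' * M\<close>, which is
  diagonal.\<close>

lemma det_on_simultaneously_diagonalizable_blocks:
  fixes B :: "'i \<Rightarrow> 'i \<Rightarrow> 'c :: idom mat"
  assumes us: "distinct us"
    and M: "M \<in> carrier_mat m m" and N: "N \<in> carrier_mat m m" and NM: "N * M = 1\<^sub>m m"
    and B: "\<And>u u'. B u u' \<in> carrier_mat m m"
    and diag: "\<And>u u'. u \<in> set us \<Longrightarrow> u' \<in> set us \<Longrightarrow> N * B u u' * M = mat_diag m (d u u')"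
  shows "det_on (List.product us [0..<m]) (\<lambda>(u, i) (u', j). B u u' $$ (i, j))
    = (\<Prod>i<m. det_on us (\<lambda>u u'. d u u' i))"
proof -
  let ?ks = "List.product us [0..<m]"
  \<comment> \<open>The Kronecker product of the identity on \<open>us\<close> with
    \<open>A\<close>: one copy of \<open>A\<close> for each element of \<open>us\<close>.\<close>
  let ?lift = "\<lambda>A (u, i) (u', j). if u = u' then A $$ (i, j) else (0 :: 'c)"
  let ?b = "\<lambda>(u, i) (u', j). B u u' $$ (i, j)"
  let ?d = "\<lambda>(u, i) (u', j). if i = j then d u u' i else 0"
  have ks: "distinct ?ks" using us by (simp add: distinct_product)
  \<comment> \<open>A factor \<open>?lift A\<close> on the left or on the right collapses the sum
    over all pairs to a sum over the second coordinate within one block.\<close>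
  have left: "(\<Sum>s\<in>set ?ks. ?lift A p s * g s) = (\<Sum>k<m. A $$ (snd p, k) * g (fst p, k))"
    if "p \<in> set ?ks" for A g and p :: "'i \<times> nat"
  proof -
    have "(\<Sum>s\<in>set ?ks. ?lift A p s * g s) =
      (\<Sum>u\<in>set us. \<Sum>k<m. if fst p = u then A $$ (snd p, k) * g (u, k) else 0)"
      by (simp add: sum.cartesian_product atLeast0LessThan split_def)
         (rule sum.cong, auto)
    also have "\<dots> = (\<Sum>u\<in>set us. if fst p = u then \<Sum>k<m. A $$ (snd p, k) * g (u, k) else 0)"
      by (rule sum.cong) auto
    also have "\<dots> = (\<Sum>k<m. A $$ (snd p, k) * g (fst p, k))"
      using that by (auto simp: sum.delta')
    finally show ?thesis .
  qed
  have right: "(\<Sum>s\<in>set ?ks. g s * ?lift A s q) = (\<Sum>k<m. g (fst q, k) * A $$ (k, snd q))"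
    if "q \<in> set ?ks" for A g and q :: "'i \<times> nat"
  proof -
    have "(\<Sum>s\<in>set ?ks. g s * ?lift A s q) =
      (\<Sum>u\<in>set us. \<Sum>k<m. if u = fst q then g (u, k) * A $$ (k, snd q) else 0)"
      by (simp add: sum.cartesian_product atLeast0LessThan split_def)
         (rule sum.cong, auto)
    also have "\<dots> = (\<Sum>u\<in>set us. if u = fst q then \<Sum>k<m. g (u, k) * A $$ (k, snd q) else 0)"
      by (rule sum.cong) auto
    also have "\<dots> = (\<Sum>k<m. g (fst q, k) * A $$ (k, snd q))"
      using that by (auto simp: sum.delta)
    finally show ?thesis .
  qed
  have entry: "(X * Y) $$ (i, j) = (\<Sum>k<m. X $$ (i, k) * Y $$ (k, j))"
    if "X \<in> carrier_mat m m" "Y \<in> carrier_mat m m" "i < m" "j < m" for X Y :: "'c mat" and i j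
    using that by (auto simp: scalar_prod_def atLeast0LessThan)
  have "det_on ?ks (?lift N) * det_on ?ks (?lift M) =
      det_on ?ks (\<lambda>p q. \<Sum>s\<in>set ?ks. ?lift N p s * ?lift M s q)"
    by (rule det_on_mult[OF ks])
  also have "\<dots> = det_on ?ks (\<lambda>p q. if p = q then 1 else 0)"
  proof (rule det_on_cong[OF refl])
    fix p q assume p: "p \<in> set ?ks" and q: "q \<in> set ?ks"
    have "(\<Sum>k<m. N $$ (snd p, k) * M $$ (k, snd q)) = (N * M) $$ (snd p, snd q)"
      using p q by (intro entry[symmetric] N M) auto
    then show "(\<Sum>s\<in>set ?ks. ?lift N p s * ?lift M s q) = (if p = q then 1 else 0)"
      unfolding left[OF p] using p q by (cases p; cases q; cases "fst p = fst q") (auto simp: NM)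
  qed
  also have "\<dots> = det (1\<^sub>m (length ?ks))"
    unfolding det_on_def
    by (rule arg_cong[where f = det], rule eq_matI) (auto simp: nth_eq_iff_index_eq[OF ks])
  finally have unit: "det_on ?ks (?lift N) * det_on ?ks (?lift M) = 1" by simp
  have "det_on ?ks ?b = det_on ?ks (?lift N) * det_on ?ks ?b * det_on ?ks (?lift M)"
    using unit by (simp add: mult.commute mult.left_commute)
  also have "\<dots> = det_on ?ks ?d"
    unfolding det_on_mult[OF ks]
  proof (rule det_on_cong[OF refl])
    fix p q assume p: "p \<in> set ?ks" and q: "q \<in> set ?ks"
    obtain u i u' j where pq: "p = (u, i)" "q = (u', j)" by (cases p; cases q)
    have i: "i < m" "u \<in> set us" and j: "j < m" "u' \<in> set us" using p q pq by auto
    have NB: "N * B u u' \<in> carrier_mat m m" using N B by simp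
    have "(\<Sum>s\<in>set ?ks. (\<Sum>t\<in>set ?ks. ?lift N p t * ?b t s) * ?lift M s q) =
        (\<Sum>k<m. (\<Sum>l<m. N $$ (i, l) * B u u' $$ (l, k)) * M $$ (k, j))"
      unfolding right[OF q] left[OF p] by (simp add: pq)
    also have "\<dots> = (\<Sum>k<m. (N * B u u') $$ (i, k) * M $$ (k, j))"
      by (rule sum.cong) (simp_all add: entry[OF N B i(1)] del: index_mult_mat)
    also have "\<dots> = (N * B u u' * M) $$ (i, j)"
      by (rule entry[symmetric, OF NB M i(1) j(1)])
    also have "\<dots> = ?d p q"
      unfolding diag[OF i(2) j(2)] using i j by (simp add: mat_diag_def pq)
    finally show "(\<Sum>s\<in>set ?ks. (\<Sum>t\<in>set ?ks. ?lift N p t * ?b t s) * ?lift M s q) = ?d p q" .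
  qed
  \<comment> \<open>The entries \<open>?d\<close> vanish unless the second coordinates agree.
    Listing the pairs by second coordinate first therefore exposes \<open>m\<close> diagonal blocks,
    each indexed by \<open>us\<close>.\<close>
  also have "\<dots> = det_on (concat (map (\<lambda>i. map (\<lambda>u. (u, i)) us) [0..<m])) ?d"
  proof (rule det_on_reorder[OF ks])
    have "concat (map (\<lambda>i. map (\<lambda>u. (u, i)) us) [0..<m]) = map prod.swap (List.product [0..<m] us)"
      by (simp add: product_concat_map map_concat comp_def)
    then show "distinct (concat (map (\<lambda>i. map (\<lambda>u. (u, i)) us) [0..<m]))"
      using us by (simp add: distinct_map distinct_product)
  qed auto
  also have "\<dots> = (\<Prod>i\<in>set [0..<m]. det_on (map (\<lambda>u. (u, i)) us) ?d)"
    by (rule det_on_block_diagonal) auto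
  also have "\<dots> = (\<Prod>i<m. det_on us (\<lambda>u u'. d u u' i))"
    by (rule prod.cong) (auto simp: det_on_map)
  finally show ?thesis .
qed

section \<open>Degrees in the graph bundle\<close>

lemma out_degree_with_proj: "out_degree (with_proj X) u = card {v. (u, v) \<in> parcs X}"
proof -
  have "out_arcs (with_proj X) u = Pair u ` {v. (u, v) \<in> parcs X}"
    by (auto simp: out_arcs_def)
  then show ?thesis by (simp add: out_degree_def card_image inj_on_def)
qed

text \<open>Each neighbour \<open>u'\<close> of \<open>u\<close> contributes exactly one neighbour
  of \<open>(u, v)\<close>, since the voltage fixes its second coordinate; the other neighbours lie
  in the fibre over \<open>u\<close>. The two kinds are disjoint because \<open>G\<close> has no
  loops.\<close>

lemma out_degree_graph_bundle:
  assumes G: "pair_graph G" and F: "pair_graph F"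
    and \<phi>: "\<And>e v. e \<in> parcs G \<Longrightarrow> v \<in> pverts F \<Longrightarrow> \<phi> e v \<in> pverts F"
    and u: "u \<in> pverts G" and v: "v \<in> pverts F"
  shows "out_degree (with_proj (graph_bundle G \<phi> F)) (u, v) =
    out_degree (with_proj G) u + out_degree (with_proj F) v"
proof -
  interpret G: pair_graph G by fact
  interpret F: pair_graph F by fact
  let ?h = "\<lambda>u'. (u', \<phi> (u, u') v)" and ?NG = "{u'. (u, u') \<in> parcs G}"
  let ?NF = "{v'. (v, v') \<in> parcs F}"
  have eq: "{w. ((u, v), w) \<in> parcs (graph_bundle G \<phi> F)} = ?h ` ?NG \<union> Pair u ` ?NF"
    using u v \<phi> G.in_arcsD2 F.in_arcsD2 by (auto simp: graph_bundle_def)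
  have fin: "finite ?NG" "finite ?NF"
    using finite_subset[OF _ G.pair_finite_verts, of ?NG] finite_subset[OF _ F.pair_finite_verts, of ?NF]
      G.in_arcsD2 F.in_arcsD2 by auto
  have disj: "?h ` ?NG \<inter> Pair u ` ?NF = {}"
    using G.no_loops'[of u u] by auto
  show ?thesis
    unfolding out_degree_with_proj eq card_Un_disjoint[OF finite_imageI[OF fin(1)] finite_imageI[OF fin(2)] disj]
    by (simp add: card_image inj_on_def)
qed

section \<open>Factorization of the characteristic function of the bundle\<close>

theorem theorem3p8:
  fixes G :: "'a pair_pre_digraph" and F :: "'b pair_pre_digraph"
    and r :: nat
    and \<phi> :: "'a \<times> 'a \<Rightarrow> 'b \<Rightarrow> 'b" and \<Gamma> :: "('b \<Rightarrow> 'b) set"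
    and us :: "'a list" and vs :: "'b list" and ws :: "('a \<times> 'b) list"
    and M Minv :: "complex mat"
    and ev :: "('b \<Rightarrow> 'b) \<Rightarrow> nat \<Rightarrow> complex" and evF :: "nat \<Rightarrow> complex"
    and x \<mu> :: complex
  assumes "pair_graph G" and "Digraph_Component.connected (with_proj G)"
    and "pair_graph F" and "Digraph_Component.connected (with_proj F)" and "regular r F"
    and "enumerates us (pverts G)" and "enumerates vs (pverts F)"
    and "enumerates ws (pverts (graph_bundle G \<phi> F))"
    and "subgroup \<Gamma> (Aut_group F)" and "comm_group ((Aut_group F)\<lparr>carrier := \<Gamma>\<rparr>)"
    and "voltage_assignment G F \<phi>" and "\<forall>e \<in> parcs G. \<phi> e \<in> \<Gamma>"
    and "M \<in> carrier_mat (length vs) (length vs)"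
    and "Minv \<in> carrier_mat (length vs) (length vs)"
    and "inverts_mat M Minv" and "inverts_mat Minv M"
    and "\<forall>\<gamma> \<in> \<Gamma>. Minv * perm_mat vs \<gamma> * M = mat_diag (length vs) (ev \<gamma>)"
    and "Minv * adjacency_mat vs F * M = mat_diag (length vs) evF"
  shows "gen_char ws (graph_bundle G \<phi> F) x \<mu> =
    (\<Prod>i<length vs. weighted_gen_char us (with_proj G) (voltage_weight G \<phi> ev i)
       (x + of_nat r * \<mu> - evF i) \<mu>)"
proof -
  interpret G: pair_graph G by fact
  let ?m = "length vs"
  let ?deg = "\<lambda>u. of_nat (out_degree (with_proj G) u) :: complex"
  have us: "distinct us" "set us = pverts G" and vs: "distinct vs" "set vs = pverts F"
    and ws: "distinct ws" "set ws = pverts G \<times> pverts F"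
    using assms(6-8) by (auto simp: enumerates_def graph_bundle_def)
  have \<phi>: "\<phi> e v \<in> pverts F" if "e \<in> parcs G" "v \<in> pverts F" for e v
  proof -
    have "\<phi> e \<in> Bij (pverts F)"
      using assms(11) that(1) by (auto simp: voltage_assignment_def Aut_group_def graph_auts_def)
    then show ?thesis using that(2) Bij_imp_funcset by blast
  qed
  \<comment> \<open>The scalar that \<lambda>I + \<mu>D contributes on the fibre over
    \<open>u\<close>: every bundle vertex there has degree \<open>?deg u + r\<close>.\<close>
  define c where "c u = x + \<mu> * (?deg u + of_nat r)" for u
  \<comment> \<open>The block of \<lambda>I - (A - \<mu>D) for the bundle with rows in the fibre
    over \<open>u\<close> and columns in the fibre over \<open>u'\<close>; \<open>d u u' i\<close>
    is its \<open>i\<close>-th diagonal entry after conjugation by \<open>M\<close>.\<close>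
  define B where "B u u' = (if u = u' then c u \<cdot>\<^sub>m 1\<^sub>m ?m - adjacency_mat vs F else 0\<^sub>m ?m ?m)
    - (if (u, u') \<in> parcs G then perm_mat vs (\<phi> (u, u')) else 0\<^sub>m ?m ?m)" for u u'
  define d where "d u u' i = (if u = u' then c u - evF i else 0)
    - (if (u, u') \<in> parcs G then ev (\<phi> (u, u')) i else 0)" for u u' i
  have A: "adjacency_mat vs F \<in> carrier_mat ?m ?m"
    and P: "\<And>\<gamma>. perm_mat vs \<gamma> \<in> carrier_mat ?m ?m"
    by (auto simp: adjacency_mat_def perm_mat_def)
  have B: "B u u' \<in> carrier_mat ?m ?m" for u u'
    using A P by (auto simp: B_def intro!: minus_carrier_mat)
  have NM: "Minv * M = 1\<^sub>m ?m"
    using assms(14,16) by (simp add: inverts_mat_def)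
  have sub: "Minv * (X - Y) * M = Minv * X * M - Minv * Y * M"
    if "X \<in> carrier_mat ?m ?m" "Y \<in> carrier_mat ?m ?m" for X Y
    using assms(13,14) that
    by (simp add: mult_minus_distrib_mat[of _ ?m ?m] minus_mult_distrib_mat[of _ ?m ?m])
  have diag: "Minv * B u u' * M = mat_diag ?m (d u u')" for u u'
  proof -
    have "Minv * (if u = u' then c u \<cdot>\<^sub>m 1\<^sub>m ?m - adjacency_mat vs F else 0\<^sub>m ?m ?m) * M =
        mat_diag ?m (\<lambda>i. if u = u' then c u - evF i else 0)"
    proof (cases "u = u'")
      case True
      have "Minv * (c u \<cdot>\<^sub>m 1\<^sub>m ?m) * M = c u \<cdot>\<^sub>m 1\<^sub>m ?m"
        using assms(14) NM
        by (simp add: mult_smult_distrib[OF assms(14) one_carrier_mat] mult_smult_assoc_mat[OF assms(14,13)])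
      then show ?thesis
        using True A by (subst if_P, simp, subst sub) (auto simp: assms(18) mat_diag_def)
    next
      case False
      then show ?thesis using assms(13,14) by (auto simp: mat_diag_def)
    qed
    moreover have "Minv * (if (u, u') \<in> parcs G then perm_mat vs (\<phi> (u, u')) else 0\<^sub>m ?m ?m) * M =
        mat_diag ?m (\<lambda>i. if (u, u') \<in> parcs G then ev (\<phi> (u, u')) i else 0)"
      using assms(12-14,17) by (auto simp: mat_diag_def)
    ultimately show ?thesis
      unfolding B_def using A P by (subst sub) (auto simp: mat_diag_def d_def)
  qed
  \<comment> \<open>The entries of the same bundle matrix, indexed by vertices, so that the given
    listing \<open>ws\<close> can be exchanged for the fibrewise one.\<close>
  define f where "f p q = (if p = q then x + \<mu> * of_nat (out_degree (with_proj (graph_bundle G \<phi> F)) p)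
    else 0) - (if (p, q) \<in> parcs (graph_bundle G \<phi> F) then 1 else 0)" for p q
  let ?ks = "List.product us [0..<?m]" and ?h = "\<lambda>(u, i). (u, vs ! i)"
  have "gen_char ws (graph_bundle G \<phi> F) x \<mu> = det_on ws f"
    unfolding gen_char_def det_on_def
    by (rule arg_cong[where f = det], rule eq_matI)
       (auto simp: adjacency_mat_def deg_mat_def mat_diag_def f_def nth_eq_iff_index_eq[OF ws(1)])
  also have "\<dots> = det_on (map ?h ?ks) f"
  proof (rule det_on_reorder[OF ws(1)])
    show "distinct (map ?h ?ks)"
      using us vs by (auto simp: distinct_map distinct_product inj_on_def nth_eq_iff_index_eq)
    have "pverts F = (!) vs ` {0..<?m}"
      using vs(2) by (metis list.set_map map_nth set_upt)
    then show "set ws = set (map ?h ?ks)"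
      using us(2) by (auto simp: ws(2) image_iff)
  qed
  also have "\<dots> = det_on ?ks (\<lambda>(u, i) (u', j). B u u' $$ (i, j))"
    unfolding det_on_map
  proof (rule det_on_cong[OF refl])
    fix p q assume p: "p \<in> set ?ks" and q: "q \<in> set ?ks"
    obtain u i u' j where pq: "p = (u, i)" "q = (u', j)" by (cases p; cases q)
    have i: "i < ?m" "u \<in> pverts G" "vs ! i \<in> pverts F"
      and j: "j < ?m" "u' \<in> pverts G" "vs ! j \<in> pverts F"
      using p q pq us(2) vs(2) by (auto simp: in_set_conv_nth[symmetric])
    have "out_degree (with_proj (graph_bundle G \<phi> F)) (u, vs ! i) = out_degree (with_proj G) u + r"
      using out_degree_graph_bundle[OF assms(1,3) \<phi> i(2,3)] assms(5) i(3) by (simp add: regular_def)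
    moreover have "vs ! i = vs ! j \<longleftrightarrow> i = j"
      using i j vs(1) by (simp add: nth_eq_iff_index_eq)
    \<comment> \<open>Adjacency in the bundle is a disjunction with entry 1, whereas
      \<open>B\<close> subtracts the two contributions separately. Without loops in \<open>G\<close>
      the alternatives exclude each other, so nothing is counted twice.\<close>
    moreover have "(u, u) \<notin> parcs G" using G.no_loops' by blast
    ultimately show "f (?h p) (?h q) = (case p of (u, i) \<Rightarrow> \<lambda>(u', j). B u u' $$ (i, j)) q"
      using i j
      by (auto simp: pq f_def B_def c_def graph_bundle_def adjacency_mat_def perm_mat_def)
  qed
  also have "\<dots> = (\<Prod>i<?m. det_on us (\<lambda>u u'. d u u' i))"
    by (rule det_on_simultaneously_diagonalizable_blocks[OF us(1) assms(13,14) NM B diag])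
  also have "\<dots> = (\<Prod>i<?m. weighted_gen_char us (with_proj G) (voltage_weight G \<phi> ev i)
       (x + of_nat r * \<mu> - evF i) \<mu>)"
  proof (rule prod.cong[OF refl])
    fix i
    \<comment> \<open>There is at most one arc from \<open>u\<close> to \<open>u'\<close>, so the
      weighted adjacency entry is a single eigenvalue or 0.\<close>
    have arcs: "{e. e \<in> parcs G \<and> fst e = u \<and> snd e = u'} = (if (u, u') \<in> parcs G then {(u, u')} else {})"
      for u u' by auto
    \<comment> \<open>On the diagonal, \<open>c u - evF i\<close> equals
      \<open>(x + of_nat r * \<mu> - evF i) + \<mu> * ?deg u\<close>: the fibre degree and the
      eigenvalue of \<open>F\<close> shift the first argument, and the degree in \<open>G\<close>
      remains as vertex weight.\<close>
    show "det_on us (\<lambda>u u'. d u u' i) =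
      weighted_gen_char us (with_proj G) (voltage_weight G \<phi> ev i) (x + of_nat r * \<mu> - evF i) \<mu>"
      unfolding weighted_gen_char_def det_on_def
      by (rule arg_cong[where f = det], rule eq_matI)
         (auto simp: weighted_adjacency_mat_def weighted_deg_mat_def mat_diag_def d_def c_def arcs
           voltage_weight_def nth_eq_iff_index_eq[OF us(1)] algebra_simps)
  qed
  finally show ?thesis .
qed

end
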